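(* Let $n\in\mathbb{N}$ and let $u\approx v$ be a non-trivial monoid identity satisfied by $\mathsf{styl}_n$. Then $u\approx v\in J_n$, that is, $u$ and $v$ share the same subsequences of length $\le n$.
   Context: $\mathbb{N}=\{1,2,3,\dots\}$ and $\mathcal{A}_n=\{1<2<\cdots<n\}$. The stylic monoid of rank $n$, $\mathsf{styl}_n$, is the monoid presented by generators $\mathcal{A}_n$ and relations $acb=cab$ (for $a\le b<c$), $bac=bca$ (for $a<b\le c$), and $a^2=a$ (for $a\in\mathcal{A}_n$). A monoid identity over an alphabet of variables $\Sigma$ is a formal equality $u\approx v$ with $u,v\in\Sigma^*$; it is non-trivial if $u\ne v$. A monoid $M$ satisfies $u\approx v$ if $\psi(u)=\psi(v)$ for every monoid morphism $\psi\colon\Sigma^*\to M$. A word $u_1\cdots u_k$ ($u_i\in\Sigma$) is a subsequence of a word $v$ if $v=v'_1u_1v'_2\cdots v'_ku_kv'_{k+1}$ for some words $v'_i\in\Sigma^*$ (scattered subword). $J_n$ is the set of all identities $u\approx v$ such that $u$ and $v$ have the same subsequences of length $\le n$. *)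

theory Defs
  imports "HOL-Algebra.Group" "HOL-Library.Sublist"
begin

definition free_monoid :: "'x set \<Rightarrow> 'x list monoid" where
  "free_monoid X = \<lparr>carrier = lists X, mult = (@), one = []\<rparr>"

text \<open>The least monoid congruence on \<open>lists A\<close> containing the relations \<open>R\<close>.\<close>

inductive_set monoid_cong :: "'a set \<Rightarrow> ('a list \<times> 'a list) set \<Rightarrow> ('a list \<times> 'a list) set"
  for A R where
  rel: "(x, y) \<in> R \<Longrightarrow> x \<in> lists A \<Longrightarrow> y \<in> lists A \<Longrightarrow> (x, y) \<in> monoid_cong A R"
| refl: "x \<in> lists A \<Longrightarrow> (x, x) \<in> monoid_cong A R"
| sym: "(x, y) \<in> monoid_cong A R \<Longrightarrow> (y, x) \<in> monoid_cong A R"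
| trans: "(x, y) \<in> monoid_cong A R \<Longrightarrow> (y, z) \<in> monoid_cong A R \<Longrightarrow> (x, z) \<in> monoid_cong A R"
| mult: "(x, y) \<in> monoid_cong A R \<Longrightarrow> (x', y') \<in> monoid_cong A R
    \<Longrightarrow> (x @ x', y @ y') \<in> monoid_cong A R"

definition presented_monoid :: "'a set \<Rightarrow> ('a list \<times> 'a list) set \<Rightarrow> 'a list set monoid" where
  "presented_monoid A R =
    \<lparr>carrier = lists A // monoid_cong A R,
     mult = (\<lambda>P Q. \<Union>x\<in>P. \<Union>y\<in>Q. monoid_cong A R `` {x @ y}),
     one = monoid_cong A R `` {[]}\<rparr>"

definition stylic_rels :: "nat \<Rightarrow> (nat list \<times> nat list) set" where
  "stylic_rels n =
     {([a, c, b], [c, a, b]) | a b c. {a, b, c} \<subseteq> {1..n} \<and> a \<le> b \<and> b < c}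
   \<union> {([b, a, c], [b, c, a]) | a b c. {a, b, c} \<subseteq> {1..n} \<and> a < b \<and> b \<le> c}
   \<union> {([a, a], [a]) | a. a \<in> {1..n}}"

definition styl :: "nat \<Rightarrow> nat list set monoid" where
  "styl n = presented_monoid {1..n} (stylic_rels n)"

text \<open>\<open>hom\<close> only asks for multiplicativity; for monoids preservation of the unit is a
  separate requirement.\<close>

definition monoid_homs :: "('a, 'm) monoid_scheme \<Rightarrow> ('b, 'k) monoid_scheme \<Rightarrow> ('a \<Rightarrow> 'b) set" where
  "monoid_homs G H = {h \<in> hom G H. h \<one>\<^bsub>G\<^esub> = \<one>\<^bsub>H\<^esub>}"

text \<open>An identity \<open>u \<approx> v\<close> over the variables \<open>X\<close> is the pair \<open>(u, v)\<close>.\<close>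

definition identities :: "'x set \<Rightarrow> ('x list \<times> 'x list) set" where
  "identities X = lists X \<times> lists X"

definition nontrivial_identity :: "'x list \<times> 'x list \<Rightarrow> bool" where
  "nontrivial_identity e \<longleftrightarrow> fst e \<noteq> snd e"

definition satisfies_identity ::
    "('b, 'k) monoid_scheme \<Rightarrow> 'x set \<Rightarrow> 'x list \<times> 'x list \<Rightarrow> bool" where
  "satisfies_identity M X e \<longleftrightarrow> (\<forall>\<psi> \<in> monoid_homs (free_monoid X) M. \<psi> (fst e) = \<psi> (snd e))"

definition J :: "'x set \<Rightarrow> nat \<Rightarrow> ('x list \<times> 'x list) set" where
  "J X n = {(u, v) \<in> identities X.
     {w. subseq w u \<and> length w \<le> n} = {w. subseq w v \<and> length w \<le> n}}"

lemma monoid_free_monoid: "monoid (free_monoid X)"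
  by unfold_locales (auto simp: free_monoid_def)

lemma monoid_cong_in_lists:
  "(x, y) \<in> monoid_cong A R \<Longrightarrow> x \<in> lists A \<and> y \<in> lists A"
  by (induction rule: monoid_cong.induct) auto

lemma equiv_monoid_cong: "equiv (lists A) (monoid_cong A R)"
  by (rule equivI)
    (auto intro!: refl_onI symI transI
      intro: monoid_cong.refl monoid_cong.sym monoid_cong.trans dest: monoid_cong_in_lists)

lemma presented_monoid_mult:
  assumes "x \<in> lists A" "y \<in> lists A"
  shows "(monoid_cong A R `` {x}) \<otimes>\<^bsub>presented_monoid A R\<^esub> (monoid_cong A R `` {y})
    = monoid_cong A R `` {x @ y}"
proof -
  have "congruent2 (monoid_cong A R) (monoid_cong A R) (\<lambda>x y. monoid_cong A R `` {x @ y})"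
    by (auto simp: congruent2_def intro!: equiv_class_eq[OF equiv_monoid_cong] monoid_cong.mult)
  then show ?thesis
    unfolding presented_monoid_def
    using UN_equiv_class2[OF equiv_monoid_cong equiv_monoid_cong _ assms] by simp
qed

lemma monoid_presented_monoid: "monoid (presented_monoid A R)"
proof -
  have carrier: "P \<in> carrier (presented_monoid A R)
      \<longleftrightarrow> (\<exists>x \<in> lists A. P = monoid_cong A R `` {x})" for P
    by (auto simp: presented_monoid_def quotient_def)
  have one: "\<one>\<^bsub>presented_monoid A R\<^esub> = monoid_cong A R `` {[]}"
    by (simp add: presented_monoid_def)
  show ?thesis
  proof
    fix P Q S
    assume "P \<in> carrier (presented_monoid A R)" "Q \<in> carrier (presented_monoid A R)"
      "S \<in> carrier (presented_monoid A R)"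
    then obtain x y z where "x \<in> lists A" "P = monoid_cong A R `` {x}"
      "y \<in> lists A" "Q = monoid_cong A R `` {y}" "z \<in> lists A" "S = monoid_cong A R `` {z}"
      by (auto simp: carrier)
    then show "P \<otimes>\<^bsub>presented_monoid A R\<^esub> Q \<otimes>\<^bsub>presented_monoid A R\<^esub> S
        = P \<otimes>\<^bsub>presented_monoid A R\<^esub> (Q \<otimes>\<^bsub>presented_monoid A R\<^esub> S)"
      by (simp add: presented_monoid_mult del: in_lists_conv_set append_in_lists_conv
        add: append_in_lists_conv)
  next
    fix P Q
    assume "P \<in> carrier (presented_monoid A R)" "Q \<in> carrier (presented_monoid A R)"
    then obtain x y where xy: "x \<in> lists A" "P = monoid_cong A R `` {x}"
      "y \<in> lists A" "Q = monoid_cong A R `` {y}"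
      by (auto simp: carrier)
    then have "P \<otimes>\<^bsub>presented_monoid A R\<^esub> Q = monoid_cong A R `` {x @ y}"
      by (metis presented_monoid_mult)
    moreover have "x @ y \<in> lists A" using xy by simp
    ultimately show "P \<otimes>\<^bsub>presented_monoid A R\<^esub> Q \<in> carrier (presented_monoid A R)"
      unfolding carrier by blast
  next
    show "\<one>\<^bsub>presented_monoid A R\<^esub> \<in> carrier (presented_monoid A R)"
      unfolding carrier one by (rule bexI[of _ "[]"]) auto
  next
    fix P assume "P \<in> carrier (presented_monoid A R)"
    then obtain x where x: "x \<in> lists A" "P = monoid_cong A R `` {x}" by (auto simp: carrier)
    show "\<one>\<^bsub>presented_monoid A R\<^esub> \<otimes>\<^bsub>presented_monoid A R\<^esub> P = P"
      using presented_monoid_mult[of "[]" A x R] x by (simp add: one)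
    show "P \<otimes>\<^bsub>presented_monoid A R\<^esub> \<one>\<^bsub>presented_monoid A R\<^esub> = P"
      using presented_monoid_mult[of x A "[]" R] x by (simp add: one)
  qed
qed

lemma monoid_styl: "monoid (styl n)"
  unfolding styl_def by (rule monoid_presented_monoid)

end

(* Reading a word letter by letter, let a state s drop to s - 1 exactly when the letter s is read.
   The stylic relations preserve this action on states.  Given a word w of length k \<le> n, send each
   variable x to the increasing word of those i for which the i-th letter of w, counted from the
   right, is x.  Within an increasing word the state drops at most once, so the image of u takes the
   state k to 0 exactly when the greedy search for w in u succeeds. *)

theory Submission
  imports Defs
begin

definition descend :: "nat \<Rightarrow> nat \<Rightarrow> nat" where
  "descend a s = (if s = a then s - 1 else s)"

text \<open>For \<open>a < c\<close>, reading \<open>a\<close> and \<open>c\<close> in either order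
  acts differently only if \<open>c = a + 1\<close>, and then only on state \<open>c\<close>. In the
  first relation this forces \<open>b = a\<close>, and the trailing \<open>b\<close> brings both
  results to \<open>a - 1\<close>; in the second it forces \<open>b = c\<close>, and the leading
  \<open>b\<close> has already removed state \<open>c\<close>.\<close>

lemma fold_descend_stylic_rels:
  assumes "(x, y) \<in> stylic_rels n"
  shows "fold descend x s = fold descend y s"
proof -
  have "descend b (descend c (descend a s)) = descend b (descend a (descend c s))"
    if "a \<le> b" "b < c" for a b c
    using that unfolding descend_def by (cases s) auto
  moreover have "descend c (descend a (descend b s)) = descend a (descend c (descend b s))"
    if "a < b" "b \<le> c" for a b c
    using that unfolding descend_def by (cases s) auto
  moreover have "a \<ge> 1 \<Longrightarrow> descend a (descend a s) = descend a s" for a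
    by (simp add: descend_def)
  ultimately show ?thesis
    using assms unfolding stylic_rels_def by auto
qed

lemma fold_descend_cong:
  assumes "(x, y) \<in> monoid_cong A (stylic_rels n)"
  shows "fold descend x s = fold descend y s"
  using assms
  by (induction arbitrary: s rule: monoid_cong.induct) (simp_all add: fold_descend_stylic_rels)

lemma fold_descend_increasing:
  assumes "sorted_wrt (<) zs"
  shows "fold descend zs s = (if s \<in> set zs then s - 1 else s)"
  using assms
proof (induction zs arbitrary: s)
  case (Cons a zs)
  \<comment> \<open>All later letters exceed \<open>a\<close>, so the state reached by reading
    \<open>a\<close> in state \<open>a\<close> drops no further.\<close>
  then have "a \<notin> set zs" "a - 1 \<notin> set zs" by fastforce+
  with Cons show ?case by (simp add: descend_def)
qed simp

text \<open>Counting from the right makes the state the number of letters of \<open>w\<close> still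
  to be matched: state \<open>s\<close> waits for the first letter of the suffix of length
  \<open>s\<close>.\<close>

definition positions_from_right :: "'x list \<Rightarrow> 'x \<Rightarrow> nat list" where
  "positions_from_right w x = filter (\<lambda>i. w ! (length w - i) = x) [1..<Suc (length w)]"

lemma set_positions_from_right:
  "set (positions_from_right w x) = {i \<in> {1..length w}. w ! (length w - i) = x}"
  unfolding positions_from_right_def by (simp only: set_filter set_upt) auto

lemma fold_descend_positions_from_right:
  assumes "s \<le> length w"
  shows "fold descend (positions_from_right w x) s
    = (if 0 < s \<and> w ! (length w - s) = x then s - 1 else s)"
proof -
  have "sorted_wrt (<) (positions_from_right w x)"
    unfolding positions_from_right_def by (intro sorted_wrt_filter sorted_wrt_upt)
  from fold_descend_increasing[OF this] show ?thesis
    using assms by (simp add: set_positions_from_right Suc_le_eq)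
qed

text \<open>Matching each letter at its earliest occurrence loses nothing. The statement covers
  every suffix of \<open>w\<close> because the induction on \<open>u\<close> changes the
  state.\<close>

lemma fold_descend_eq_0_iff_subseq:
  assumes "s \<le> length w"
  shows "fold descend (concat (map (positions_from_right w) u)) s = 0
    \<longleftrightarrow> subseq (drop (length w - s) w) u"
  using assms
proof (induction u arbitrary: s)
  case Nil
  have "subseq xs [] \<longleftrightarrow> xs = []" for xs :: "'a list"
    by (cases xs) auto
  moreover have "drop (length w - s) w = [] \<longleftrightarrow> s = 0"
    using Nil by (simp only: drop_eq_Nil) linarith
  ultimately show ?case by simp
next
  case (Cons x u)
  show ?case
  proof (cases "s = 0")
    case True
    then show ?thesis using Cons.IH[of 0]
      by (simp add: fold_descend_positions_from_right)
  next
    case False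
    \<comment> \<open>The suffix splits into the awaited letter and the suffix for state
      \<open>s - 1\<close>; reading \<open>x\<close> removes that letter or leaves the state at
      \<open>s\<close>.\<close>
    with Cons.prems have "drop (length w - s) w
        = w ! (length w - s) # drop (length w - (s - 1)) w"
      using Cons_nth_drop_Suc[of "length w - s" w] by (simp add: Suc_diff_le)
    then show ?thesis
      using Cons.IH[of s] Cons.IH[of "s - 1"] Cons.prems False
      by (simp add: fold_descend_positions_from_right)
  qed
qed

text \<open>This is the universal property of the free monoid, followed by the quotient map.\<close>

lemma substitution_monoid_homs:
  assumes "\<And>x. f x \<in> lists A"
  shows "(\<lambda>u. monoid_cong A R `` {concat (map f u)})
    \<in> monoid_homs (free_monoid X) (presented_monoid A R)"
proof -
  have lists: "concat (map f u) \<in> lists A" for u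
    using assms by (induction u) auto
  then have carrier: "monoid_cong A R `` {concat (map f u)} \<in> carrier (presented_monoid A R)" for u
    unfolding presented_monoid_def by (simp add: quotientI)
  have "monoid_cong A R `` {concat (map f (u @ v))}
      = monoid_cong A R `` {concat (map f u)} \<otimes>\<^bsub>presented_monoid A R\<^esub> monoid_cong A R `` {concat (map f v)}"
    for u v
    unfolding presented_monoid_mult[OF lists lists] by simp
  then show ?thesis
    using carrier by (simp add: monoid_homs_def hom_def free_monoid_def presented_monoid_def)
qed

lemma satisfies_identity_presented_monoidD:
  assumes "satisfies_identity (presented_monoid A R) X (u, v)"
    and f: "\<And>x. f x \<in> lists A"
  shows "(concat (map f u), concat (map f v)) \<in> monoid_cong A R"
proof (rule eq_equiv_class[OF _ equiv_monoid_cong])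
  show "monoid_cong A R `` {concat (map f u)} = monoid_cong A R `` {concat (map f v)}"
    using assms(1) substitution_monoid_homs[of f A R X, OF f]
    by (auto simp: satisfies_identity_def)
  show "concat (map f v) \<in> lists A"
    using f by (induction v) auto
qed

theorem theorem4p1:
  fixes n :: nat and X :: "'x set" and u v :: "'x list"
  assumes "n \<ge> 1"
    and "(u, v) \<in> identities X"
    and "nontrivial_identity (u, v)"
    and "satisfies_identity (styl n) X (u, v)"
  shows "(u, v) \<in> J X n"
proof -
  have "subseq w u \<longleftrightarrow> subseq w v" if "length w \<le> n" for w
  proof -
    let ?f = "positions_from_right w"
    \<comment> \<open>The bound on \<open>length w\<close> keeps all positions within the generators
      of \<open>styl n\<close>.\<close>
    have "?f x \<in> lists {1..n}" for x
      using that by (auto simp: set_positions_from_right)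
    then have "(concat (map ?f u), concat (map ?f v)) \<in> monoid_cong {1..n} (stylic_rels n)"
      using assms(4) unfolding styl_def by (intro satisfies_identity_presented_monoidD)
    \<comment> \<open>In the starting state \<open>length w\<close>, the suffix to be matched is all
      of \<open>w\<close>.\<close>
    from fold_descend_cong[OF this, of "length w"] show ?thesis
      using fold_descend_eq_0_iff_subseq[of "length w" w u]
        fold_descend_eq_0_iff_subseq[of "length w" w v] by simp
  qed
  with assms(2) show ?thesis by (auto simp: J_def)
qed

end
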